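(* Let $\Theta\subset\mathbb{R}^d$ and let $\Phi_K:\mathbb{R}^n\times\Theta\to\mathbb{R}^n$. For every $\theta\in\Theta$ let $\widehat{x}_\theta\in\mathbb{R}^n$ be a minimizer of an energy $E_\theta:\mathbb{R}^n\to]-\infty,+\infty]$, and assume that for every $\theta\in\Theta$: (1) $\Phi_K(\cdot,\theta)$ is $\delta_K(\theta)$-Lipschitz on $\mathbb{R}^n$ with $\delta_K(\theta)<1$; (2) $\{\widehat{x}_\theta\}=\{x\in\mathbb{R}^n : \Phi_K(x,\theta)=x\}$. Let $\mathcal{L}:\mathbb{R}^n\to\mathbb{R}$ be differentiable, with gradient $\partial_x\mathcal{L}$. Then, for every $\theta\in\Theta$, the deep-equilibrium gradient $g(\theta)$ and the Jacobian-free gradient $g^{\mathrm{JF}}(\theta)$ (defined in the context) satisfy $$\|g(\theta)-g^{\mathrm{JF}}(\theta)\|_2\le\frac{\delta_K(\theta)}{1-\delta_K(\theta)}\,\|\partial_x\mathcal{L}(\widehat{x}_\theta)\|_2\,\|\partial_\theta\Phi_K(\widehat{x}_\theta,\cdot)(\theta)\|_2 .$$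
   Context: For a locally Lipschitz map $F:\mathbb{R}^p\to\mathbb{R}^N$, $\partial F(x)\subset\mathbb{R}^{N\times p}$ denotes the (Clarke) generalized Jacobian: the convex hull of all limits $\lim_k \mathrm{J}F(x_k)$ of classical Jacobians along sequences $x_k\to x$ of points of differentiability of $F$. Matrices carry the spectral norm $\|\cdot\|_2$, and $\|\partial F(x)\|_2:=\sup_{M\in\partial F(x)}\|M\|_2$. $\partial_x\Phi_K(\cdot,\theta)(x)$ is the generalized Jacobian of $\Phi_K(\cdot,\theta)$ at $x$, and $\partial_\theta\Phi_K(x,\cdot)(\theta)$ is the generalized Jacobian of $\Phi_K(x,\cdot)$ at $\theta$; for the latter to make sense, $\Phi_K(\widehat{x}_\theta,\cdot)$ is assumed Lipschitz in a neighbourhood of $\theta$. For arbitrary $H\in\partial_x\Phi_K(\cdot,\theta)(\widehat{x}_\theta)\subset\mathbb{R}^{n\times n}$ and $M\in\partial_\theta\Phi_K(\widehat{x}_\theta,\cdot)(\theta)\subset\mathbb{R}^{n\times d}$ (the same $M$ in both gradients), $$g(\theta):=\partial_x\mathcal{L}(\widehat{x}_\theta)^\top[\mathrm{Id}-H]^{-1}M,\qquad g^{\mathrm{JF}}(\theta):=\partial_x\mathcal{L}(\widehat{x}_\theta)^\top M .$$ When $\Phi_K$ is continuously differentiable, $H$ and $M$ are simply the Jacobian matrices of $\Phi_K$ in $x$ and in $\theta$ at $(\widehat{x}_\theta,\theta)$. The statement holds for every such choice of $H$ and $M$. *)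

theory Defs
  imports "HOL-Analysis.Analysis"
begin

definition spectral_norm :: "real ^ 'n ^ 'm \<Rightarrow> real" where
  "spectral_norm A = onorm ((*v) A)"

(* Meaningful for maps that are Lipschitz in a neighbourhood of x.
   The matrix type real ^ 'p ^ 'm has rows indexed by 'm and columns by 'p. *)
definition generalized_jacobian ::
    "(real ^ 'p \<Rightarrow> real ^ 'm) \<Rightarrow> real ^ 'p \<Rightarrow> (real ^ 'p ^ 'm) set" where
  "generalized_jacobian F x = convex hull
     {A. \<exists>X :: nat \<Rightarrow> real ^ 'p.
          (\<forall>k. F differentiable (at (X k))) \<and> X \<longlonglongrightarrow> x \<and>
          (\<lambda>k. jacobian F (at (X k))) \<longlonglongrightarrow> A}"

(* A real supremum, so only meaningful for nonempty bounded S. The generalized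
   Jacobian at x of a map that is Lipschitz near x is bounded. *)
definition set_spectral_norm :: "(real ^ 'n ^ 'm) set \<Rightarrow> real" where
  "set_spectral_norm S = (SUP A\<in>S. spectral_norm A)"

(* Row vectors v^T A are written v v* A. The argument v is the gradient of the loss
   at the fixed point; H and M are elements of the generalized Jacobians of the
   iteration map with respect to the state and to the parameter. *)
definition deq_gradient ::
    "real ^ 'n \<Rightarrow> real ^ 'n ^ 'n \<Rightarrow> real ^ 'd ^ 'n \<Rightarrow> real ^ 'd" where
  "deq_gradient v H M = (v v* matrix_inv (mat 1 - H)) v* M"

definition jf_gradient :: "real ^ 'n \<Rightarrow> real ^ 'd ^ 'n \<Rightarrow> real ^ 'd" where
  "jf_gradient v M = v v* M"

end

theory Submission
  imports Defs
begin

text \<open>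
  Derivatives of a \<open>C\<close>-Lipschitz map have operator norm at most \<open>C\<close>, and this bound survives limits and
  convex combinations; hence \<open>H\<close> has spectral norm at most \<open>\<delta> < 1\<close> and \<open>Id - H\<close> is invertible. The row
  vector \<open>w = v (Id - H)\<^sup>-\<^sup>1\<close> satisfies \<open>w = v + w H\<close>, so \<open>\<bar>w\<bar> \<le> \<bar>v\<bar> / (1 - \<delta>)\<close> and
  \<open>\<bar>w - v\<bar> = \<bar>w H\<bar> \<le> \<delta> / (1 - \<delta>) \<bar>v\<bar>\<close>. Multiplying \<open>w - v\<close> by \<open>M\<close> gives the claim.
\<close>

text \<open>The difference quotients of \<open>f\<close> along the line
  \<open>x + t *\<^sub>R h\<close> are bounded by \<open>C * norm h\<close> and tend to
  \<open>f' h\<close>. Openness of \<open>U\<close> keeps the line inside \<open>U\<close> for small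
  \<open>t\<close>, so a local Lipschitz bound suffices.\<close>

lemma norm_has_derivative_le_lipschitz:
  fixes f :: "'a::real_normed_vector \<Rightarrow> 'b::real_normed_vector"
  assumes f': "(f has_derivative f') (at x)"
    and lip: "C-lipschitz_on U f" and "open U" "x \<in> U"
  shows "norm (f' h) \<le> C * norm h"
proof -
  have lin: "((\<lambda>t. x + t *\<^sub>R h) has_derivative (\<lambda>t. t *\<^sub>R h)) (at (0::real))"
    by (auto intro!: derivative_eq_intros)
  have "((\<lambda>t. f (x + t *\<^sub>R h)) has_derivative (\<lambda>t. f' (t *\<^sub>R h))) (at (0::real))"
    using has_derivative_compose[OF lin, of f f'] f' by simp
  then have "((\<lambda>t. norm (f (x + t *\<^sub>R h) - f x - t *\<^sub>R f' h) / \<bar>t\<bar>) \<longlongrightarrow> 0) (at (0::real))"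
    by (simp add: has_derivative_iff_norm linear_scale[OF has_derivative_linear[OF f']])
  then have lim: "((\<lambda>t. C * norm h + norm (f (x + t *\<^sub>R h) - f x - t *\<^sub>R f' h) / \<bar>t\<bar>)
      \<longlongrightarrow> C * norm h) (at (0::real))"
    using tendsto_add[OF tendsto_const] by fastforce
  have "((\<lambda>t::real. x + t *\<^sub>R h) \<longlongrightarrow> x) (at 0)"
    by (auto intro!: tendsto_eq_intros)
  then have "\<forall>\<^sub>F t in at (0::real). x + t *\<^sub>R h \<in> U"
    using topological_tendstoD assms(3,4) by blast
  \<comment> \<open>The quotient is split into its Lipschitz bound and the remainder over
    \<open>\<bar>t\<bar>\<close>; the latter vanishes in the limit \<open>lim\<close>.\<close>
  then have "\<forall>\<^sub>F t in at (0::real).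
      norm (f' h) \<le> C * norm h + norm (f (x + t *\<^sub>R h) - f x - t *\<^sub>R f' h) / \<bar>t\<bar>"
    using eventually_neq_at_within[of "0::real" 0 UNIV]
  proof eventually_elim
    case (elim t)
    let ?d = "f (x + t *\<^sub>R h) - f x"
    have "norm ?d \<le> C * (\<bar>t\<bar> * norm h)"
      using lipschitz_onD[OF lip elim(1) \<open>x \<in> U\<close>] by (simp add: dist_norm)
    moreover have "\<bar>t\<bar> * norm (f' h) \<le> norm ?d + norm (?d - t *\<^sub>R f' h)"
      using norm_triangle_ineq4[of ?d "?d - t *\<^sub>R f' h"] by simp
    ultimately show ?case
      using elim(2) by (simp add: field_simps)
  qed
  then show ?thesis
    using tendsto_lowerbound[OF lim] by simp
qed

lemma spectral_norm_leI:
  assumes "\<And>x. norm (A *v x) \<le> C * norm x"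
  shows "spectral_norm A \<le> C"
  unfolding spectral_norm_def using assms by (intro onorm_le)

lemma norm_mult_le_spectral_norm: "norm (A *v x) \<le> spectral_norm A * norm x"
  unfolding spectral_norm_def by (intro onorm matrix_vector_mul_bounded_linear)

lemma spectral_norm_nonneg: "0 \<le> spectral_norm A"
  unfolding spectral_norm_def by (intro onorm_pos_le matrix_vector_mul_bounded_linear)

text \<open>Pairing \<open>u v* A\<close> with itself moves \<open>A\<close> to the other side,
  where Cauchy-Schwarz applies. This avoids comparing the spectral norms of \<open>A\<close> and its
  transpose.\<close>

lemma norm_vector_matrix_mult_le:
  fixes A :: "real ^ 'n ^ 'm"
  shows "norm (u v* A) \<le> norm u * spectral_norm A"
proof -
  have "norm (u v* A) * norm (u v* A) = inner u (A *v (u v* A))"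
    by (metis dot_lmul_matrix power2_eq_square power2_norm_eq_inner)
  also have "\<dots> \<le> norm u * (spectral_norm A * norm (u v* A))"
    by (meson norm_cauchy_schwarz norm_mult_le_spectral_norm mult_left_mono norm_ge_zero order_trans)
  finally have "norm (u v* A) * norm (u v* A) \<le> norm u * spectral_norm A * norm (u v* A)"
    by (simp add: mult.assoc)
  then show ?thesis
    by (cases "u v* A = 0") (simp_all add: spectral_norm_nonneg)
qed

text \<open>The set \<open>U\<close> is left general to cover two uses: the whole space for the
  state variable and a small ball for the parameter.\<close>

lemma spectral_norm_generalized_jacobian_le:
  fixes F :: "real ^ 'p \<Rightarrow> real ^ 'm"
  assumes lip: "C-lipschitz_on U F" and "open U" "x \<in> U"
    and A: "A \<in> generalized_jacobian F x"
  shows "spectral_norm A \<le> C"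
proof -
  \<comment> \<open>The norm ball is written vector by vector, so that convexity is the triangle
    inequality and limits can be taken at each fixed \<open>h\<close>.\<close>
  let ?B = "{A :: real ^ 'p ^ 'm. \<forall>h. norm (A *v h) \<le> C * norm h}"
  have "convex ?B"
  proof (rule convexI, clarify)
    fix A B :: "real ^ 'p ^ 'm" and u v :: real and h
    assume *: "\<forall>h. norm (A *v h) \<le> C * norm h" "\<forall>h. norm (B *v h) \<le> C * norm h"
      and uv: "0 \<le> u" "0 \<le> v" "u + v = 1"
    have "norm ((u *\<^sub>R A + v *\<^sub>R B) *v h) \<le> u * norm (A *v h) + v * norm (B *v h)"
      using norm_triangle_ineq[of "u *\<^sub>R (A *v h)" "v *\<^sub>R (B *v h)"] uv
      by (simp add: matrix_vector_mult_add_rdistrib flip: scaleR_matrix_vector_assoc)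
    also have "\<dots> \<le> u * (C * norm h) + v * (C * norm h)"
      using * uv by (intro add_mono mult_left_mono) auto
    also have "\<dots> = C * norm h"
      using uv by (metis distrib_right mult_1)
    finally show "norm ((u *\<^sub>R A + v *\<^sub>R B) *v h) \<le> C * norm h" .
  qed
  moreover have "B \<in> ?B"
    if dif: "\<And>k. F differentiable at (X k)" and X: "X \<longlonglongrightarrow> x"
      and J: "(\<lambda>k. jacobian F (at (X k))) \<longlonglongrightarrow> B" for X :: "nat \<Rightarrow> real ^ 'p" and B
  proof clarify
    fix h
    have "(\<lambda>k. jacobian F (at (X k)) *v h) \<longlonglongrightarrow> B *v h"
      unfolding matrix_vector_mult_def
      by (intro tendsto_intros tendsto_vec_nth J)
    \<comment> \<open>Only the tail of \<open>X\<close> need lie in \<open>U\<close>, which is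
      enough for the limit.\<close>
    moreover have "\<forall>\<^sub>F k in sequentially. norm (jacobian F (at (X k)) *v h) \<le> C * norm h"
      using topological_tendstoD[OF X \<open>open U\<close> \<open>x \<in> U\<close>]
    proof eventually_elim
      case (elim k)
      show ?case
        using norm_has_derivative_le_lipschitz[OF _ lip \<open>open U\<close> elim] dif jacobian_works by blast
    qed
    ultimately show "norm (B *v h) \<le> C * norm h"
      using tendsto_upperbound[OF tendsto_norm] by fastforce
  qed
  ultimately have "generalized_jacobian F x \<subseteq> ?B"
    unfolding generalized_jacobian_def by (intro hull_minimal) blast+
  then show ?thesis
    using A by (intro spectral_norm_leI) blast
qed

text \<open>A real supremum dominates its members only when the set is bounded above; any uniform
  bound \<open>C\<close> provides this.\<close>

lemma spectral_norm_le_set_spectral_norm: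
  assumes "\<And>A. A \<in> S \<Longrightarrow> spectral_norm A \<le> C" and "M \<in> S"
  shows "spectral_norm M \<le> set_spectral_norm S"
  unfolding set_spectral_norm_def using assms by (intro cSUP_upper bdd_aboveI2)

text \<open>A kernel vector is fixed by \<open>H\<close>, which strictly shrinks nonzero vectors; a
  square matrix with trivial kernel is invertible.\<close>

lemma invertible_mat_1_minus:
  fixes H :: "real ^ 'n ^ 'n"
  assumes "spectral_norm H < 1"
  shows "invertible (mat 1 - H)"
proof -
  have "x = 0" if "(mat 1 - H) *v x = 0" for x
  proof (rule ccontr)
    assume "x \<noteq> 0"
    have "norm x = norm (H *v x)"
      using that by (simp add: matrix_vector_mult_diff_rdistrib)
    also have "\<dots> \<le> spectral_norm H * norm x"
      by (rule norm_mult_le_spectral_norm)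
    also have "\<dots> < norm x"
      using assms \<open>x \<noteq> 0\<close> by simp
    finally show False by simp
  qed
  then show ?thesis
    by (simp add: invertible_left_inverse matrix_left_invertible_ker)
qed

lemma matrix_inv_left:
  assumes "invertible A"
  shows "matrix_inv A ** A = mat 1"
  using someI_ex[OF assms[unfolded invertible_def]] by (simp add: matrix_inv_def)

text \<open>This is the linear algebra for one fixed pair \<open>H\<close>, \<open>M\<close>; the
  supremum over the generalized Jacobian enters only afterwards.\<close>

lemma norm_deq_gradient_minus_jf_gradient_le:
  fixes H :: "real ^ 'n ^ 'n" and M :: "real ^ 'd ^ 'n"
  assumes H: "spectral_norm H \<le> \<delta>" and "\<delta> < 1"
  shows "norm (deq_gradient v H M - jf_gradient v M) \<le> \<delta> / (1 - \<delta>) * norm v * spectral_norm M"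
proof -
  define w where "w = v v* matrix_inv (mat 1 - H)"
  have "w v* (mat 1 - H) = v"
    unfolding w_def using assms
    by (simp add: vector_matrix_mul_assoc matrix_inv_left invertible_mat_1_minus)
  then have w: "w - v = w v* H"
    by (simp add: vector_matrix_mult_diff_rdistrib algebra_simps)
  have wH: "norm (w v* H) \<le> \<delta> * norm w"
    using norm_vector_matrix_mult_le[of w H] mult_right_mono[OF H norm_ge_zero[of w]]
    by (simp add: mult.commute)
  have "norm w \<le> norm v + norm (w v* H)"
    using norm_triangle_ineq[of v "w - v"] unfolding w[symmetric] by simp
  \<comment> \<open>The term \<open>\<delta> * norm w\<close> is absorbed on the left.\<close>
  with wH have "(1 - \<delta>) * norm w \<le> norm v"
    by (simp add: algebra_simps)
  then have "norm w \<le> norm v / (1 - \<delta>)"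
    using \<open>\<delta> < 1\<close> by (simp add: field_simps)
  moreover have "0 \<le> \<delta>"
    using spectral_norm_nonneg H by (rule order_trans)
  ultimately have "\<delta> * norm w \<le> \<delta> / (1 - \<delta>) * norm v"
    using mult_left_mono by fastforce
  with wH w have wv: "norm (w - v) \<le> \<delta> / (1 - \<delta>) * norm v"
    by simp
  have "deq_gradient v H M - jf_gradient v M = (w - v) v* M"
    by (simp add: deq_gradient_def jf_gradient_def w_def vector_matrix_mult_diff_distrib)
  then have "norm (deq_gradient v H M - jf_gradient v M) \<le> norm (w - v) * spectral_norm M"
    using norm_vector_matrix_mult_le by metis
  also have "\<dots> \<le> \<delta> / (1 - \<delta>) * norm v * spectral_norm M"
    using wv by (intro mult_right_mono spectral_norm_nonneg)
  finally show ?thesis .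
qed

theorem lemma1:
  fixes \<Theta> :: "(real ^ 'd) set"
    and \<Phi> :: "real ^ 'n \<Rightarrow> real ^ 'd \<Rightarrow> real ^ 'n"
    and E :: "real ^ 'd \<Rightarrow> real ^ 'n \<Rightarrow> ereal"
    and xhat :: "real ^ 'd \<Rightarrow> real ^ 'n"
    and \<delta> :: "real ^ 'd \<Rightarrow> real"
    and L :: "real ^ 'n \<Rightarrow> real"
    and gradL :: "real ^ 'n \<Rightarrow> real ^ 'n"
  assumes energy: "\<And>\<theta> x. \<theta> \<in> \<Theta> \<Longrightarrow> E \<theta> x \<noteq> -\<infinity>"
    and minimizer: "\<And>\<theta> x. \<theta> \<in> \<Theta> \<Longrightarrow> E \<theta> (xhat \<theta>) \<le> E \<theta> x"
    and contraction: "\<And>\<theta>. \<theta> \<in> \<Theta> \<Longrightarrow> (\<delta> \<theta>)-lipschitz_on UNIV (\<lambda>x. \<Phi> x \<theta>)"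
    and contraction_less_1: "\<And>\<theta>. \<theta> \<in> \<Theta> \<Longrightarrow> \<delta> \<theta> < 1"
    and fixed_point: "\<And>\<theta>. \<theta> \<in> \<Theta> \<Longrightarrow> {xhat \<theta>} = {x. \<Phi> x \<theta> = x}"
    and parameter_lipschitz:
      "\<And>\<theta>. \<theta> \<in> \<Theta> \<Longrightarrow> \<exists>e>0. \<exists>C. C-lipschitz_on (ball \<theta> e) (\<lambda>\<theta>'. \<Phi> (xhat \<theta>) \<theta>')"
    and loss_gradient: "\<And>x. GDERIV L x :> gradL x"
  shows "\<forall>\<theta>\<in>\<Theta>.
     \<forall>H\<in>generalized_jacobian (\<lambda>x. \<Phi> x \<theta>) (xhat \<theta>).
     \<forall>M\<in>generalized_jacobian (\<lambda>\<theta>'. \<Phi> (xhat \<theta>) \<theta>') \<theta>.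
       norm (deq_gradient (gradL (xhat \<theta>)) H M - jf_gradient (gradL (xhat \<theta>)) M)
       \<le> \<delta> \<theta> / (1 - \<delta> \<theta>) * norm (gradL (xhat \<theta>))
          * set_spectral_norm (generalized_jacobian (\<lambda>\<theta>'. \<Phi> (xhat \<theta>) \<theta>') \<theta>)"
proof (intro ballI)
  fix \<theta> H M
  assume \<theta>: "\<theta> \<in> \<Theta>"
    and H: "H \<in> generalized_jacobian (\<lambda>x. \<Phi> x \<theta>) (xhat \<theta>)"
    and M: "M \<in> generalized_jacobian (\<lambda>\<theta>'. \<Phi> (xhat \<theta>) \<theta>') \<theta>"
  let ?v = "gradL (xhat \<theta>)" and ?J = "generalized_jacobian (\<lambda>\<theta>'. \<Phi> (xhat \<theta>) \<theta>') \<theta>"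
  obtain e C where "e > 0" "C-lipschitz_on (ball \<theta> e) (\<lambda>\<theta>'. \<Phi> (xhat \<theta>) \<theta>')"
    using parameter_lipschitz[OF \<theta>] by blast
  \<comment> \<open>The constant \<open>C\<close> serves to make the supremum over \<open>?J\<close>
    finite and does not enter the final estimate.\<close>
  then have "\<And>A. A \<in> ?J \<Longrightarrow> spectral_norm A \<le> C"
    by (intro spectral_norm_generalized_jacobian_le[of C "ball \<theta> e"]) auto
  then have M': "spectral_norm M \<le> set_spectral_norm ?J"
    using M by (rule spectral_norm_le_set_spectral_norm)
  have H': "spectral_norm H \<le> \<delta> \<theta>"
    using spectral_norm_generalized_jacobian_le[OF contraction[OF \<theta>]] H by simp
  \<comment> \<open>The sign makes the prefactor nonnegative, so that \<open>spectral_norm M\<close>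
    may be replaced by the supremum.\<close>
  have "0 \<le> \<delta> \<theta>"
    using lipschitz_on_nonneg[OF contraction[OF \<theta>]] .
  have "norm (deq_gradient ?v H M - jf_gradient ?v M)
      \<le> \<delta> \<theta> / (1 - \<delta> \<theta>) * norm ?v * spectral_norm M"
    using H' contraction_less_1[OF \<theta>] by (rule norm_deq_gradient_minus_jf_gradient_le)
  also have "\<dots> \<le> \<delta> \<theta> / (1 - \<delta> \<theta>) * norm ?v * set_spectral_norm ?J"
    using M' \<open>0 \<le> \<delta> \<theta>\<close> contraction_less_1[OF \<theta>] by (intro mult_left_mono) auto
  finally show "norm (deq_gradient ?v H M - jf_gradient ?v M)
      \<le> \<delta> \<theta> / (1 - \<delta> \<theta>) * norm ?v * set_spectral_norm ?J" .
qed

end
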